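(* Consider the single-cell downlink with aged CSI and MRT precoding described in the context, with $K$, $\tau$, $\alpha$ and $\beta_1,\dots,\beta_K$ fixed. Fix $E_u>0$, $E_b>0$ and $\beta>0$; let the users' uplink pilot transmit power be $p_u=E_u/\sqrt M$ (so $p_p=\tau E_u/\sqrt M$) and the BS transmit power be $p_b=E_b/M^\beta$. Then for every $k\in\{1,\dots,K\}$, $$R_k^{\mathrm{dl}}-\log_2\left(1+\frac{\alpha^2\tau E_uE_b\beta_k^4}{M^{\beta-\frac12}\sum_{i=1}^K\beta_i^2}\right)\longrightarrow0\qquad(M\to\infty).$$
   Context: The exponent $\beta$ (no subscript) is unrelated to the constants $\beta_1,\dots,\beta_K$. System: a base station (BS) with $M$ antennas and $K\le M$ single-antenna users; $p_u>0$ is the uplink (pilot) transmit power per user, $\tau\ge K$ the training length, $p_p:=\tau p_u$, $p_b>0$ the BS transmit power, and $\beta_1,\dots,\beta_K>0$ are constants. The channel vector of user $k$ at time $n$ is $\mathbf g_k[n]\in\mathbb C^M$ with i.i.d. $\mathcal{CN}(0,\beta_k)$ entries, independent across users. Estimation: the BS observes $\tilde{\mathbf y}_k[n]=\mathbf g_k[n]+\frac{1}{\sqrt{p_p}}\mathbf b_k[n]$, where the $\mathbf b_k[n]$ have i.i.d. $\mathcal{CN}(0,1)$ entries, are independent across $k$ and independent of the channels. The MMSE estimate is $\hat{\mathbf g}_k[n]=\frac{p_p\beta_k}{1+p_p\beta_k}\tilde{\mathbf y}_k[n]$, with entries of variance $\sigma_k^2=\frac{p_p\beta_k^2}{1+p_p\beta_k}$.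 Aging: $\mathbf g_k[n+1]=\alpha\mathbf g_k[n]+\mathbf e_k[n+1]$, where $\alpha$ is real with $0<|\alpha|\le1$, and the $\mathbf e_k[n+1]$ are independent across $k$ and of the foregoing, with i.i.d. $\mathcal{CN}(0,(1-\alpha^2)\beta_k)$ entries. The BS uses the aged CSI $\bar{\mathbf g}_k[n+1]=\alpha\hat{\mathbf g}_k[n]$. Downlink rate: with MRT precoding matrix $\mathbf W=\lambda\bar{\mathbf G}^*[n+1]$, $\bar{\mathbf G}=[\bar{\mathbf g}_1,\dots,\bar{\mathbf g}_K]$ and $\lambda=\left(M\alpha^2\sum_{k=1}^K\sigma_k^2\right)^{-1/2}$, the achievable downlink rate of user $k$ is defined as $$R_k^{\mathrm{dl}}=\log_2\left(1+\frac{|\mathrm E\{\mathbf g_k^T\bar{\mathbf g}_k^*\}|^2}{\mathrm{Var}(\mathbf g_k^T\bar{\mathbf g}_k^* )+\sum_{i=1,i\ne k}^K\mathrm E\{|\mathbf g_k^T\bar{\mathbf g}_i^*|^2\}+\frac1{p_b\lambda^2}}\right),$$ with all vectors taken at time $n+1$, $^*$ denoting complex conjugate and $\mathrm{Var}(X)=\mathrm E|X|^2-|\mathrm E X|^2$. *)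

theory Defs
  imports "HOL-Probability.Probability"
begin

text \<open>
  Circularly symmetric complex normal law with mean 0 and variance \<open>v\<close>: real and imaginary parts
  are independent with variance \<open>v/2\<close> each. Defining it as an image of the standard Gaussian
  includes the degenerate case \<open>v = 0\<close> (the point mass at 0), which occurs for the innovation when
  \<open>\<bar>\<alpha>\<bar> = 1\<close>.
\<close>
definition complex_normal :: "real \<Rightarrow> complex measure" where
  "complex_normal v =
     distr (density lborel std_normal_density \<Otimes>\<^sub>M density lborel std_normal_density) borel
       (\<lambda>(x, y). of_real (sqrt (v / 2)) * Complex x y)"

definition complex_variance :: "'a measure \<Rightarrow> ('a \<Rightarrow> complex) \<Rightarrow> real" where
  "complex_variance P X = (\<integral>\<omega>. (cmod (X \<omega>))\<^sup>2 \<partial>P) - (cmod (\<integral>\<omega>. X \<omega> \<partial>P))\<^sup>2"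

datatype source = Channel | Noise | Innovation

text \<open>
  \<open>g t k m\<close> is the \<open>m\<close>-th entry of the channel vector of user \<open>k\<close> at time \<open>t\<close>; \<open>b\<close> and \<open>e\<close> are
  indexed in the same way. Users are numbered \<open>1..K\<close> and antennas \<open>1..M\<close>. The assumptions concern
  a single time step from \<open>n\<close> to \<open>n + 1\<close>.
\<close>
locale aged_downlink = prob_space P
  for P :: "'a measure" +
  fixes M K \<tau> n :: nat
    and p_u p_b \<alpha> :: real
    and \<beta> :: "nat \<Rightarrow> real"
    and g b e :: "nat \<Rightarrow> nat \<Rightarrow> nat \<Rightarrow> 'a \<Rightarrow> complex"
  assumes users: "K \<le> M"
    and training: "K \<le> \<tau>"
    and p_u: "0 < p_u"
    and p_b: "0 < p_b"
    and \<alpha>: "0 < \<bar>\<alpha>\<bar>" "\<bar>\<alpha>\<bar> \<le> 1"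
    and \<beta>: "\<And>k. k \<in> {1..K} \<Longrightarrow> 0 < \<beta> k"
    and indep: "indep_vars (\<lambda>_. borel)
          (\<lambda>(s, k, m). case s of Channel \<Rightarrow> g n k m | Noise \<Rightarrow> b n k m | Innovation \<Rightarrow> e (Suc n) k m)
          (UNIV \<times> {1..K} \<times> {1..M})"
    and g_law: "\<And>k m. k \<in> {1..K} \<Longrightarrow> m \<in> {1..M} \<Longrightarrow>
          distr P borel (g n k m) = complex_normal (\<beta> k)"
    and b_law: "\<And>k m. k \<in> {1..K} \<Longrightarrow> m \<in> {1..M} \<Longrightarrow>
          distr P borel (b n k m) = complex_normal 1"
    and e_law: "\<And>k m. k \<in> {1..K} \<Longrightarrow> m \<in> {1..M} \<Longrightarrow>
          distr P borel (e (Suc n) k m) = complex_normal ((1 - \<alpha>\<^sup>2) * \<beta> k)"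
    and aging: "\<And>k m \<omega>. k \<in> {1..K} \<Longrightarrow> m \<in> {1..M} \<Longrightarrow> \<omega> \<in> space P \<Longrightarrow>
          g (Suc n) k m \<omega> = of_real \<alpha> * g n k m \<omega> + e (Suc n) k m \<omega>"
begin

definition p_p :: real where
  "p_p = real \<tau> * p_u"

definition observation :: "nat \<Rightarrow> nat \<Rightarrow> 'a \<Rightarrow> complex" where
  "observation k m \<omega> = g n k m \<omega> + of_real (1 / sqrt p_p) * b n k m \<omega>"

definition mmse_estimate :: "nat \<Rightarrow> nat \<Rightarrow> 'a \<Rightarrow> complex" where
  "mmse_estimate k m \<omega> = of_real (p_p * \<beta> k / (1 + p_p * \<beta> k)) * observation k m \<omega>"

definition estimate_variance :: "nat \<Rightarrow> real" where
  "estimate_variance k = p_p * (\<beta> k)\<^sup>2 / (1 + p_p * \<beta> k)"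

text \<open>The CSI used at time \<open>n + 1\<close>.\<close>
definition aged_csi :: "nat \<Rightarrow> nat \<Rightarrow> 'a \<Rightarrow> complex" where
  "aged_csi k m \<omega> = of_real \<alpha> * mmse_estimate k m \<omega>"

text \<open>Normalisation \<open>\<lambda>\<close> of the maximum ratio transmission precoder.\<close>
definition mrt_scale :: real where
  "mrt_scale = (real M * \<alpha>\<^sup>2 * (\<Sum>k = 1..K. estimate_variance k)) powr (-1/2)"

text \<open>The product of the transposed channel vector of user \<open>k\<close> at time \<open>n + 1\<close> with the conjugated
  CSI vector of user \<open>i\<close>.\<close>
definition effective_gain :: "nat \<Rightarrow> nat \<Rightarrow> 'a \<Rightarrow> complex" where
  "effective_gain k i \<omega> = (\<Sum>m = 1..M. g (Suc n) k m \<omega> * cnj (aged_csi i m \<omega>))"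

definition downlink_rate :: "nat \<Rightarrow> real" where
  "downlink_rate k =
     log 2 (1 + (cmod (\<integral>\<omega>. effective_gain k k \<omega> \<partial>P))\<^sup>2 /
       (complex_variance P (effective_gain k k)
        + (\<Sum>i \<in> {1..K} - {k}. \<integral>\<omega>. (cmod (effective_gain k i \<omega>))\<^sup>2 \<partial>P)
        + 1 / (p_b * mrt_scale\<^sup>2)))"

end

end

theory Submission
  imports Defs
begin

text \<open>
  The rate has a closed form for every \<open>M\<close>. At a single antenna the term
  \<open>g\<^sub>k[n+1] cnj(y\<^sub>i)\<close>, with \<open>y\<^sub>i\<close> the observation, has mean \<open>\<alpha> \<beta>\<^sub>k\<close> if \<open>i = k\<close> and \<open>0\<close> otherwise,
  and in both cases its variance is \<open>\<beta>\<^sub>k (\<beta>\<^sub>i + 1 / p\<^sub>p)\<close>: for \<open>i = k\<close> the Gaussian fourth moment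
  \<open>E \<bar>z\<bar>\<^sup>4 = 2 v\<^sup>2\<close> contributes just the square of the mean. These terms are independent over the
  antennas, so the interference and the self-interference combine into one sum over all users, and
  the SINR equals \<open>M \<alpha>\<^sup>2 \<sigma>\<^sub>k\<^sup>4 / ((\<Sum>i. \<sigma>\<^sub>i\<^sup>2) (\<beta>\<^sub>k + 1 / p\<^sub>b))\<close>. Under the power scaling its
  ratio to the claimed SINR tends to 1. Neither SINR need be bounded, but a ratio tending to 1 already
  suffices for the difference of the logarithms of \<open>1 + SINR\<close> to vanish.
\<close>

section \<open>Moments of the complex normal law\<close>

text \<open>Fubini for a product integrand. Applied to powers, it reduces the mixed moments of real
  and imaginary part to one-dimensional Gaussian moments.\<close>

lemma has_bochner_integral_pair_mult:
  fixes f :: "'a \<Rightarrow> 'c::{real_normed_field,banach,second_countable_topology}"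
  assumes "sigma_finite_measure M" "sigma_finite_measure N"
    and f: "has_bochner_integral M f a" and g: "has_bochner_integral N g b"
  shows "has_bochner_integral (M \<Otimes>\<^sub>M N) (\<lambda>z. f (fst z) * g (snd z)) (a * b)"
proof -
  interpret pair_sigma_finite M N
    using assms(1,2) by (simp add: pair_sigma_finite_def)
  have [measurable]: "f \<in> borel_measurable M" "g \<in> borel_measurable N"
    using f g by (auto simp: has_bochner_integral_iff)
  have [simp]: "integrable M f" "integrable N g"
    using f g by (auto simp: has_bochner_integral_iff)
  have int: "integrable (M \<Otimes>\<^sub>M N) (\<lambda>z. f (fst z) * g (snd z))"
    by (rule Fubini_integrable) (auto simp: norm_mult)
  have "(\<integral>z. f (fst z) * g (snd z) \<partial>(M \<Otimes>\<^sub>M N)) = (\<integral>x. (\<integral>y. f x * g y \<partial>N) \<partial>M)"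
    using integral_fst'[OF int] by simp
  also have "\<dots> = a * b"
    using f g by (simp add: has_bochner_integral_iff)
  finally show ?thesis
    using int by (simp add: has_bochner_integral_iff)
qed

lemma measurable_cnj [measurable]: "cnj \<in> borel_measurable borel"
  by (intro borel_measurable_continuous_onI continuous_intros)

text \<open>With \<open>s^2 = v / 2\<close> and independent standard normal \<open>x\<close>,
  \<open>y\<close>, the squared modulus is \<open>s^2 * (x^2 + y^2)\<close>. Squaring once more and
  using that \<open>x^4\<close> has mean 3 gives \<open>s^4 * (3 + 2 + 3) = 2 * v^2\<close>.\<close>

lemma complex_normal_moments:
  assumes "0 \<le> v"
  shows "has_bochner_integral (complex_normal v) (\<lambda>z. z) 0"
    and "has_bochner_integral (complex_normal v) (\<lambda>z. (cmod z)\<^sup>2) v"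
    and "has_bochner_integral (complex_normal v) (\<lambda>z. (cmod z) ^ 4) (2 * v\<^sup>2)"
proof -
  define N where "N = density lborel std_normal_density"
  define s where "s = sqrt (v / 2)"
  interpret N: real_distribution N
    unfolding N_def by (rule real_dist_normal_dist)
  have sf: "sigma_finite_measure N"
    by unfold_locales
  have s2: "s\<^sup>2 = v / 2"
    using assms by (simp add: s_def)
  have m: "has_bochner_integral N (\<lambda>x. x ^ 0) 1" "has_bochner_integral N (\<lambda>x. x ^ 1) 0"
    "has_bochner_integral N (\<lambda>x. x ^ 2) 1" "has_bochner_integral N (\<lambda>x. x ^ 4) 3"
    using std_normal_moment_even[of 0] std_normal_moment_odd[of 0] std_normal_moment_even[of 1]
      std_normal_moment_even[of 2]
    unfolding N_def by (simp_all add: has_bochner_integral_density normal_density_nonneg fact_numeral)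
  note pm = has_bochner_integral_pair_mult[OF sf sf]
  have [measurable]: "(\<lambda>p. of_real s * Complex (fst p) (snd p)) \<in> borel_measurable (N \<Otimes>\<^sub>M N)"
    unfolding Complex_eq N_def by measurable
  have cn: "complex_normal v = distr (N \<Otimes>\<^sub>M N) borel (\<lambda>(x, y). of_real s * Complex x y)"
    by (simp add: complex_normal_def N_def s_def)
  have pm: "has_bochner_integral (N \<Otimes>\<^sub>M N) (\<lambda>z. fst z ^ i * snd z ^ j) (a * c)"
    if "has_bochner_integral N (\<lambda>x. x ^ i) a" "has_bochner_integral N (\<lambda>x. x ^ j) c" for i j a c
    using has_bochner_integral_pair_mult[OF sf sf that] .
  have norm2: "(cmod (of_real s * Complex x y))\<^sup>2 = s\<^sup>2 * (x\<^sup>2 + y\<^sup>2)" for x y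
    by (simp add: norm_mult power_mult_distrib cmod_power2)
  \<comment> \<open>Zeroth powers are kept so that every term is a monomial to which
    \<open>pm\<close> applies; the other two moments are written likewise.\<close>
  have "has_bochner_integral (N \<Otimes>\<^sub>M N)
      (\<lambda>z. of_real s * (of_real (fst z ^ 1 * snd z ^ 0) + \<i> * of_real (fst z ^ 0 * snd z ^ 1)))
      (of_real s * (of_real (0 * 1) + \<i> * of_real (1 * 0)))"
    by (intro has_bochner_integral_mult_right has_bochner_integral_add has_bochner_integral_of_real
        pm m)
  then show "has_bochner_integral (complex_normal v) (\<lambda>z. z) 0"
    unfolding cn by (simp add: has_bochner_integral_distr case_prod_unfold Complex_eq[symmetric])
  have "has_bochner_integral (N \<Otimes>\<^sub>M N)
      (\<lambda>z. s\<^sup>2 * (fst z ^ 2 * snd z ^ 0 + fst z ^ 0 * snd z ^ 2)) (s\<^sup>2 * (1 * 1 + 1 * 1))"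
    by (intro has_bochner_integral_mult_right has_bochner_integral_add pm m)
  then show "has_bochner_integral (complex_normal v) (\<lambda>z. (cmod z)\<^sup>2) v"
    unfolding cn by (simp add: has_bochner_integral_distr case_prod_unfold norm2 s2)
  have norm4: "(cmod (of_real s * Complex x y)) ^ 4 =
      s ^ 4 * (x ^ 4 * y ^ 0 + 2 * (x ^ 2 * y ^ 2) + x ^ 0 * y ^ 4)" for x y
    using arg_cong[OF norm2[of x y], of "\<lambda>t. t\<^sup>2"] by (simp add: power2_eq_square power4_eq_xxxx algebra_simps)
  have s4: "s ^ 4 = v\<^sup>2 / 4"
    using arg_cong[OF s2, of "\<lambda>t. t\<^sup>2"] by (simp add: power2_eq_square power4_eq_xxxx)
  have "has_bochner_integral (N \<Otimes>\<^sub>M N)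
      (\<lambda>z. s ^ 4 * (fst z ^ 4 * snd z ^ 0 + 2 * (fst z ^ 2 * snd z ^ 2) + fst z ^ 0 * snd z ^ 4))
      (s ^ 4 * (3 * 1 + 2 * (1 * 1) + 1 * 3))"
    by (intro has_bochner_integral_mult_right has_bochner_integral_add pm m)
  then show "has_bochner_integral (complex_normal v) (\<lambda>z. (cmod z) ^ 4) (2 * v\<^sup>2)"
    unfolding cn by (simp add: has_bochner_integral_distr case_prod_unfold norm4 s4)
qed

section \<open>Second moments of products and sums of independent variables\<close>

text \<open>Domination by the sum of the squared moduli. The factors may be dependent, as
  \<open>S\<close> and \<open>cnj T\<close> are below.\<close>

lemma integrable_mult_of_squares:
  fixes X Y :: "'a \<Rightarrow> complex"
  assumes [measurable]: "X \<in> borel_measurable M" "Y \<in> borel_measurable M"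
    and "integrable M (\<lambda>\<omega>. (cmod (X \<omega>))\<^sup>2)" "integrable M (\<lambda>\<omega>. (cmod (Y \<omega>))\<^sup>2)"
  shows "integrable M (\<lambda>\<omega>. X \<omega> * Y \<omega>)"
proof (rule Bochner_Integration.integrable_bound)
  show "integrable M (\<lambda>\<omega>. (cmod (X \<omega>))\<^sup>2 + (cmod (Y \<omega>))\<^sup>2)"
    using assms by simp
  have "cmod (x * y) \<le> (cmod x)\<^sup>2 + (cmod y)\<^sup>2" for x y
  proof -
    have "0 \<le> cmod x * cmod y"
      by simp
    with sum_squares_bound[of "cmod x" "cmod y"] show ?thesis
      unfolding norm_mult mult.assoc by linarith
  qed
  then show "AE \<omega> in M. cmod (X \<omega> * Y \<omega>) \<le> norm ((cmod (X \<omega>))\<^sup>2 + (cmod (Y \<omega>))\<^sup>2)"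
    by simp
qed measurable

text \<open>Take the constant 1 as second factor; its square is integrable on a probability
  space.\<close>

lemma (in prob_space) integrable_of_square:
  fixes X :: "'a \<Rightarrow> complex"
  assumes "X \<in> borel_measurable M" "integrable M (\<lambda>\<omega>. (cmod (X \<omega>))\<^sup>2)"
  shows "integrable M X"
  using integrable_mult_of_squares[OF assms(1) _ assms(2), of "\<lambda>_. 1"] by simp

text \<open>\<open>S\<close> and \<open>T\<close> may depend on each other through \<open>V\<close>,
  while \<open>Z\<close> is centred and independent of \<open>V\<close>. Expanding the square leaves
  the cross term \<open>2 * Re (S * cnj T * cnj Z)\<close>, whose mean vanishes because
  \<open>S * cnj T\<close> is a function of \<open>V\<close>.\<close>

lemma (in prob_space) moments_add_mult_indep:
  fixes s t z :: "'b \<Rightarrow> complex"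
  assumes indep: "indep_var N V N' W"
    and [measurable]: "s \<in> borel_measurable N" "t \<in> borel_measurable N" "z \<in> borel_measurable N'"
  defines "S \<equiv> \<lambda>\<omega>. s (V \<omega>)" and "T \<equiv> \<lambda>\<omega>. t (V \<omega>)" and "Z \<equiv> \<lambda>\<omega>. z (W \<omega>)"
  assumes S: "integrable M (\<lambda>\<omega>. (cmod (S \<omega>))\<^sup>2)"
    and T: "integrable M (\<lambda>\<omega>. (cmod (T \<omega>))\<^sup>2)"
    and Z: "integrable M (\<lambda>\<omega>. (cmod (Z \<omega>))\<^sup>2)" "expectation Z = 0"
  shows "has_bochner_integral M (\<lambda>\<omega>. (cmod (S \<omega> + T \<omega> * Z \<omega>))\<^sup>2)
      (expectation (\<lambda>\<omega>. (cmod (S \<omega>))\<^sup>2)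
        + expectation (\<lambda>\<omega>. (cmod (T \<omega>))\<^sup>2) * expectation (\<lambda>\<omega>. (cmod (Z \<omega>))\<^sup>2))"
    and "has_bochner_integral M (\<lambda>\<omega>. S \<omega> + T \<omega> * Z \<omega>) (expectation S)"
proof -
  have [measurable]: "V \<in> measurable M N" "W \<in> measurable M N'"
    using indep by (auto dest: indep_var_rv1 indep_var_rv2)
  have [measurable]: "S \<in> borel_measurable M" "T \<in> borel_measurable M" "Z \<in> borel_measurable M"
    by (auto simp: S_def T_def Z_def)
  have factor: "indep_var borel (\<lambda>\<omega>. f (V \<omega>)) borel (\<lambda>\<omega>. h (W \<omega>))"
    if "f \<in> borel_measurable N" "h \<in> borel_measurable N'"
    for f h :: "'b \<Rightarrow> 'x::topological_space"
    using indep_var_compose[OF indep that] by (simp add: comp_def)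
  have factors: "indep_var borel T borel Z"
    "indep_var borel (\<lambda>\<omega>. (cmod (T \<omega>))\<^sup>2) borel (\<lambda>\<omega>. (cmod (Z \<omega>))\<^sup>2)"
    "indep_var borel (\<lambda>\<omega>. S \<omega> * cnj (T \<omega>)) borel (\<lambda>\<omega>. cnj (Z \<omega>))"
    unfolding S_def T_def Z_def by (rule factor; measurable)+
  have ZI: "integrable M Z" and SI: "integrable M S" and TI: "integrable M T"
    using S T Z by (auto intro: integrable_of_square)
  have "has_bochner_integral M (\<lambda>\<omega>. T \<omega> * Z \<omega>) 0"
    using indep_var_integrable[OF factors(1) TI ZI]
      indep_var_lebesgue_integral[OF factors(1) TI ZI] Z
    by (simp add: has_bochner_integral_iff)
  from has_bochner_integral_add[OF has_bochner_integral_integrable[OF SI] this]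
  show "has_bochner_integral M (\<lambda>\<omega>. S \<omega> + T \<omega> * Z \<omega>) (expectation S)"
    by simp
  have TZ: "has_bochner_integral M (\<lambda>\<omega>. (cmod (T \<omega>))\<^sup>2 * (cmod (Z \<omega>))\<^sup>2)
     (expectation (\<lambda>\<omega>. (cmod (T \<omega>))\<^sup>2) * expectation (\<lambda>\<omega>. (cmod (Z \<omega>))\<^sup>2))"
    using indep_var_integrable[OF factors(2) T Z(1)]
      indep_var_lebesgue_integral[OF factors(2) T Z(1)]
    by (simp add: has_bochner_integral_iff)
  have cross: "integrable M (\<lambda>\<omega>. S \<omega> * cnj (T \<omega>))"
    by (rule integrable_mult_of_squares) (use S T in auto)
  have "has_bochner_integral M (\<lambda>\<omega>. S \<omega> * cnj (T \<omega>) * cnj (Z \<omega>)) 0"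
    using indep_var_integrable[OF factors(3) cross] ZI
      indep_var_lebesgue_integral[OF factors(3) cross] Z(2)
    by (simp add: has_bochner_integral_iff)
  from has_bochner_integral_mult_right[OF has_bochner_integral_Re[OF this], of 2]
  have cross: "has_bochner_integral M (\<lambda>\<omega>. 2 * Re (S \<omega> * cnj (T \<omega>) * cnj (Z \<omega>))) 0"
    by simp
  have "(cmod (s + t * z))\<^sup>2 = (cmod s)\<^sup>2 + (cmod t)\<^sup>2 * (cmod z)\<^sup>2 + 2 * Re (s * cnj t * cnj z)" for s t z :: complex
    unfolding cmod_power2 by (simp add: power2_eq_square algebra_simps)
  with has_bochner_integral_add[OF has_bochner_integral_add[OF has_bochner_integral_integrable[OF S] TZ] cross]
  show "has_bochner_integral M (\<lambda>\<omega>. (cmod (S \<omega> + T \<omega> * Z \<omega>))\<^sup>2)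
      (expectation (\<lambda>\<omega>. (cmod (S \<omega>))\<^sup>2)
        + expectation (\<lambda>\<omega>. (cmod (T \<omega>))\<^sup>2) * expectation (\<lambda>\<omega>. (cmod (Z \<omega>))\<^sup>2))"
    by simp
qed

text \<open>Sesquilinearity of the covariance: independence removes the off-diagonal terms. The
  summands may have nonzero means, as the gain of a user with its own CSI does.\<close>

lemma (in prob_space) complex_variance_sum_indep:
  fixes X :: "'i \<Rightarrow> 'a \<Rightarrow> complex"
  assumes "finite I" and indep: "indep_vars (\<lambda>_. borel) X I"
    and sq: "\<And>i. i \<in> I \<Longrightarrow> integrable M (\<lambda>\<omega>. (cmod (X i \<omega>))\<^sup>2)"
  shows "complex_variance M (\<lambda>\<omega>. \<Sum>i\<in>I. X i \<omega>) = (\<Sum>i\<in>I. complex_variance M (X i))"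
proof -
  have [measurable]: "X i \<in> borel_measurable M" if "i \<in> I" for i
    using indep that by (simp add: indep_vars_def)
  have XI: "integrable M (X i)" if "i \<in> I" for i
    using that by (auto intro: integrable_of_square sq)
  have prodI: "integrable M (\<lambda>\<omega>. X i \<omega> * cnj (X j \<omega>))" if "i \<in> I" "j \<in> I" for i j
    using that by (intro integrable_mult_of_squares) (auto simp: sq)
  have split: "expectation (\<lambda>\<omega>. X i \<omega> * cnj (X j \<omega>)) - expectation (X i) * cnj (expectation (X j)) =
      of_real (if i = j then complex_variance M (X i) else 0)" if ij: "i \<in> I" "j \<in> I" for i j
  proof (cases "i = j")
    case True
    then show ?thesis
      by (simp add: complex_variance_def complex_norm_square[symmetric] del: of_real_power)
  next
    case False
    have "indep_var borel ((\<lambda>f. f i) \<circ> (\<lambda>\<omega>. restrict (\<lambda>i. X i \<omega>) {i}))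
        borel ((\<lambda>f. cnj (f j)) \<circ> (\<lambda>\<omega>. restrict (\<lambda>i. X i \<omega>) {j}))"
      using ij False by (intro indep_var_compose[OF indep_var_restrict[OF indep]]) auto
    then have "indep_var borel (X i) borel (\<lambda>\<omega>. cnj (X j \<omega>))"
      by (simp add: comp_def)
    from indep_var_lebesgue_integral[OF this] show ?thesis
      using False XI ij by simp
  qed
  \<comment> \<open>The computation is complex because \<open>X * cnj X\<close> expands into a
    double sum; injectivity of \<open>of_real\<close> recovers the real identity.\<close>
  have "of_real (complex_variance M (\<lambda>\<omega>. \<Sum>i\<in>I. X i \<omega>)) =
     expectation (\<lambda>\<omega>. (\<Sum>i\<in>I. X i \<omega>) * cnj (\<Sum>i\<in>I. X i \<omega>))
       - expectation (\<lambda>\<omega>. \<Sum>i\<in>I. X i \<omega>) * cnj (expectation (\<lambda>\<omega>. \<Sum>i\<in>I. X i \<omega>))"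
    by (simp add: complex_variance_def complex_norm_square[symmetric] del: of_real_power cnj_sum)
  also have "\<dots> = (\<Sum>i\<in>I. \<Sum>j\<in>I. expectation (\<lambda>\<omega>. X i \<omega> * cnj (X j \<omega>))
       - expectation (X i) * cnj (expectation (X j)))"
    using XI prodI by (simp add: sum_product sum_subtractf Bochner_Integration.integral_sum)
  also have "\<dots> = (\<Sum>i\<in>I. \<Sum>j\<in>I. of_real (if i = j then complex_variance M (X i) else 0))"
    using split by simp
  also have "\<dots> = of_real (\<Sum>i\<in>I. complex_variance M (X i))"
    using \<open>finite I\<close> by (simp add: if_distrib[of of_real] cong: if_cong)
  finally show ?thesis
    using of_real_eq_iff by blast
qed

section \<open>The independent sources and their moments\<close>

context aged_downlink
begin

text \<open>A single family over kind, user and antenna, so that disjoint groups of channel, noise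
  and innovation entries are independent by one \<open>indep_vars\<close> fact.\<close>

definition source_entry :: "source \<times> nat \<times> nat \<Rightarrow> 'a \<Rightarrow> complex" where
  "source_entry = (\<lambda>(s, k, m). case s of
     Channel \<Rightarrow> g n k m | Noise \<Rightarrow> b n k m | Innovation \<Rightarrow> e (Suc n) k m)"

definition source_power :: "source \<times> nat \<times> nat \<Rightarrow> real" where
  "source_power = (\<lambda>(s, k, m). case s of
     Channel \<Rightarrow> \<beta> k | Noise \<Rightarrow> 1 | Innovation \<Rightarrow> (1 - \<alpha>\<^sup>2) * \<beta> k)"

abbreviation sources :: "(source \<times> nat \<times> nat) set" where
  "sources \<equiv> UNIV \<times> {1..K} \<times> {1..M}"

lemma indep_source_entry: "indep_vars (\<lambda>_. borel) source_entry sources"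
  using indep unfolding source_entry_def .

lemma measurable_source_entry [measurable]: "j \<in> sources \<Longrightarrow> source_entry j \<in> borel_measurable P"
  using indep_source_entry unfolding indep_vars_def by blast

text \<open>Transfer of the complex normal moments along the law of each source. The variance has to
  be nonnegative, which for the innovation amounts to \<open>\<alpha>^2 \<le> 1\<close>.\<close>

lemma source_moments:
  assumes j: "j \<in> sources"
  shows "has_bochner_integral P (source_entry j) 0"
    and "has_bochner_integral P (\<lambda>\<omega>. (cmod (source_entry j \<omega>))\<^sup>2) (source_power j)"
    and "has_bochner_integral P (\<lambda>\<omega>. (cmod (source_entry j \<omega>)) ^ 4) (2 * (source_power j)\<^sup>2)"
proof -
  have "0 \<le> (1 - \<alpha>\<^sup>2) * \<beta> k" if "k \<in> {1..K}" for k
    using \<beta>[OF that] \<alpha>(2) by (intro mult_nonneg_nonneg) (auto simp: abs_square_le_1)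
  then have pos: "0 \<le> source_power j"
    using j \<beta> by (auto simp: source_power_def less_imp_le split: source.split)
  have law: "distr P borel (source_entry j) = complex_normal (source_power j)"
    using j g_law b_law e_law by (auto simp: source_entry_def source_power_def split: source.split)
  have tr: "has_bochner_integral P (\<lambda>\<omega>. f (source_entry j \<omega>)) c"
    if "f \<in> borel_measurable borel" "has_bochner_integral (distr P borel (source_entry j)) f c"
    for f :: "complex \<Rightarrow> 'x::{banach, second_countable_topology}" and c
    using that integrable_distr_eq[OF measurable_source_entry[OF j] that(1)]
      integral_distr[OF measurable_source_entry[OF j] that(1)]
    by (simp add: has_bochner_integral_iff)
  note m = complex_normal_moments[OF pos, folded law]
  show "has_bochner_integral P (source_entry j) 0"
    by (rule tr[OF _ m(1)]) simp
  show "has_bochner_integral P (\<lambda>\<omega>. (cmod (source_entry j \<omega>))\<^sup>2) (source_power j)"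
    by (rule tr[OF _ m(2)]) simp
  show "has_bochner_integral P (\<lambda>\<omega>. (cmod (source_entry j \<omega>)) ^ 4) (2 * (source_power j)\<^sup>2)"
    by (rule tr[OF _ m(3)]) simp
qed

text \<open>
  The per-antenna moments are obtained by adjoining one source at a time; \<open>q\<close> accounts for the source
  entering either directly or conjugated.
\<close>
lemma moments_add_mult_source:
  fixes s t :: "(source \<times> nat \<times> nat \<Rightarrow> complex) \<Rightarrow> complex"
  assumes A: "A \<subseteq> sources" "j \<in> sources" "j \<notin> A"
    and s: "s \<in> borel_measurable (PiM A (\<lambda>_. borel))" and t: "t \<in> borel_measurable (PiM A (\<lambda>_. borel))"
    and S: "\<And>\<omega>. S \<omega> = s (restrict (\<lambda>i. source_entry i \<omega>) A)"
      "has_bochner_integral P (\<lambda>\<omega>. (cmod (S \<omega>))\<^sup>2) a"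
    and T: "\<And>\<omega>. T \<omega> = t (restrict (\<lambda>i. source_entry i \<omega>) A)"
      "has_bochner_integral P (\<lambda>\<omega>. (cmod (T \<omega>))\<^sup>2) c"
    and mean: "has_bochner_integral P S \<mu>"
    and q: "q = id \<or> q = cnj"
  shows "has_bochner_integral P (\<lambda>\<omega>. (cmod (S \<omega> + T \<omega> * q (source_entry j \<omega>)))\<^sup>2) (a + c * source_power j)"
    and "has_bochner_integral P (\<lambda>\<omega>. S \<omega> + T \<omega> * q (source_entry j \<omega>)) \<mu>"
proof -
  have ST: "S = (\<lambda>\<omega>. s (restrict (\<lambda>i. source_entry i \<omega>) A))" "T = (\<lambda>\<omega>. t (restrict (\<lambda>i. source_entry i \<omega>) A))"
    using S T by auto
  have z: "(\<lambda>x. q (x j)) \<in> borel_measurable (PiM {j} (\<lambda>_. borel))"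
    using q by auto
  have norm_q: "cmod (q x) = cmod x" for x
    using q by auto
  have "indep_var (PiM A (\<lambda>_. borel)) (\<lambda>\<omega>. restrict (\<lambda>i. source_entry i \<omega>) A)
      (PiM {j} (\<lambda>_. borel)) (\<lambda>\<omega>. restrict (\<lambda>i. source_entry i \<omega>) {j})"
    using A by (intro indep_var_restrict[OF indep_source_entry]) auto
  note mom = moments_add_mult_indep[OF this s t z, folded ST]
  have Z: "integrable P (\<lambda>\<omega>. (cmod (q (source_entry j \<omega>)))\<^sup>2)"
     "expectation (\<lambda>\<omega>. (cmod (q (source_entry j \<omega>)))\<^sup>2) = source_power j"
     "expectation (\<lambda>\<omega>. q (source_entry j \<omega>)) = 0"
    using source_moments[OF A(2)] q by (auto simp: norm_q has_bochner_integral_iff)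
  show "has_bochner_integral P (\<lambda>\<omega>. (cmod (S \<omega> + T \<omega> * q (source_entry j \<omega>)))\<^sup>2) (a + c * source_power j)"
    using mom(1) S(2) T(2) Z by (simp add: has_bochner_integral_iff ST)
  show "has_bochner_integral P (\<lambda>\<omega>. S \<omega> + T \<omega> * q (source_entry j \<omega>)) \<mu>"
    using mom(2) S(2) T(2) Z mean by (simp add: has_bochner_integral_iff ST)
qed

section \<open>Observations and per-antenna gains\<close>

lemma observation_source: "observation k m \<omega> =
    source_entry (Channel, k, m) \<omega> + of_real (1 / sqrt p_p) * source_entry (Noise, k, m) \<omega>"
  by (simp add: observation_def source_entry_def)

text \<open>The noise entry is adjoined to the channel entry, with the constant
  \<open>1 / sqrt p_p\<close> as multiplier.\<close>

lemma observation_power: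
  assumes "k \<in> {1..K}" "m \<in> {1..M}"
  shows "has_bochner_integral P (\<lambda>\<omega>. (cmod (observation k m \<omega>))\<^sup>2) (\<beta> k + (1 / sqrt p_p)\<^sup>2)"
proof -
  have "has_bochner_integral P (\<lambda>\<omega>. (cmod (source_entry (Channel, k, m) \<omega>
      + of_real (1 / sqrt p_p) * id (source_entry (Noise, k, m) \<omega>)))\<^sup>2)
      (source_power (Channel, k, m) + (cmod (of_real (1 / sqrt p_p)))\<^sup>2 * source_power (Noise, k, m))"
    using assms
    by (intro moments_add_mult_source(1)[where A="{(Channel, k, m)}" and s="\<lambda>x. x (Channel, k, m)"
          and t="\<lambda>_. of_real (1 / sqrt p_p)" and \<mu>=0] source_moments) (auto simp: has_bochner_integral_iff prob_space)
  then show ?thesis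
    by (simp add: observation_source source_power_def norm_divide power_divide)
qed

text \<open>The channel entry at time \<open>n + 1\<close> times the conjugated observation, with
  the aging recursion expanded and the deterministic factors of the CSI left out. The grouping
  isolates the innovation, which is adjoined last.\<close>

definition gain_entry :: "nat \<Rightarrow> nat \<Rightarrow> nat \<Rightarrow> 'a \<Rightarrow> complex" where
  "gain_entry k i m \<omega> =
     of_real \<alpha> * (source_entry (Channel, k, m) \<omega> * cnj (observation i m \<omega>))
       + cnj (observation i m \<omega>) * source_entry (Innovation, k, m) \<omega>"

text \<open>The product \<open>X\<close> of the channel entry at time \<open>n\<close> and the
  conjugated observation has mean \<open>C\<close> and variance
  \<open>\<beta> k * (\<beta> i + d^2)\<close>. Scaling by \<alpha> and adjoining the innovation
  multiplies the mean by \<alpha> but preserves the variance, because \<open>\<alpha>^2 * \<beta> k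
  + (1 - \<alpha>^2) * \<beta> k = \<beta> k\<close>.\<close>

lemma gain_entry_moments:
  assumes k: "k \<in> {1..K}" and i: "i \<in> {1..K}" and m: "m \<in> {1..M}"
  shows "has_bochner_integral P (gain_entry k i m) (if i = k then of_real (\<alpha> * \<beta> k) else 0)"
    and "has_bochner_integral P (\<lambda>\<omega>. (cmod (gain_entry k i m \<omega>))\<^sup>2)
      (\<beta> k * (\<beta> i + (1 / sqrt p_p)\<^sup>2) + (if i = k then (\<alpha> * \<beta> k)\<^sup>2 else 0))"
proof -
  define d where "d = 1 / sqrt p_p"
  define X where "X \<omega> = source_entry (Channel, k, m) \<omega> * cnj (observation i m \<omega>)" for \<omega>
  define C where "C = (if i = k then \<beta> k else 0)"
  define A where "A = {(Channel, k, m), (Channel, i, m), (Noise, i, m)}"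
  have O: "has_bochner_integral P (\<lambda>\<omega>. (cmod (cnj (observation i m \<omega>)))\<^sup>2) (\<beta> i + d\<^sup>2)"
    using observation_power[OF i m] by (simp add: d_def)
  have XA: "has_bochner_integral P (\<lambda>\<omega>. (cmod (X \<omega>))\<^sup>2) (\<beta> k * (\<beta> i + d\<^sup>2) + C\<^sup>2) \<and>
     has_bochner_integral P X (of_real C)"
  proof (cases "i = k")
    case True
    \<comment> \<open>For \<open>i = k\<close>, \<open>X\<close> is the squared modulus of the
      channel entry plus \<open>d\<close> times that entry times the conjugated noise. The first
      part has second moment \<open>2 * (\<beta> k)^2\<close>, by the fourth moment; the noise is
      the source to adjoin, with \<open>q = cnj\<close>.\<close>
    have m2: "has_bochner_integral P (\<lambda>\<omega>. source_entry (Channel, k, m) \<omega> * cnj (source_entry (Channel, k, m) \<omega>))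
        (of_real (\<beta> k))"
      using has_bochner_integral_of_real[OF source_moments(2)[of "(Channel, k, m)"], where 'a=complex] k m
      by (simp add: complex_norm_square source_power_def del: of_real_power)
    have m4: "has_bochner_integral P
        (\<lambda>\<omega>. (cmod (source_entry (Channel, k, m) \<omega> * cnj (source_entry (Channel, k, m) \<omega>)))\<^sup>2) (2 * (\<beta> k)\<^sup>2)"
      using source_moments(3)[of "(Channel, k, m)"] k m
      by (simp add: norm_mult power2_eq_square power4_eq_xxxx source_power_def algebra_simps)
    have m2d: "has_bochner_integral P
        (\<lambda>\<omega>. (cmod (of_real d * source_entry (Channel, k, m) \<omega>))\<^sup>2) (d\<^sup>2 * \<beta> k)"
      using has_bochner_integral_mult_right[OF source_moments(2)[of "(Channel, k, m)"], of "d\<^sup>2"] k m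
      by (simp add: norm_mult power_mult_distrib source_power_def)
    have *: "{(Channel, k, m)} \<subseteq> sources" "(Noise, k, m) \<in> sources" "(Noise, k, m) \<notin> {(Channel, k, m)}"
      using k m by auto
    note mom = moments_add_mult_source[OF * _ _ _ m4 _ m2d m2,
      of "\<lambda>x. x (Channel, k, m) * cnj (x (Channel, k, m))" "\<lambda>x. of_real d * x (Channel, k, m)" cnj]
    have X: "X \<omega> = source_entry (Channel, k, m) \<omega> * cnj (source_entry (Channel, k, m) \<omega>)
       + (of_real d * source_entry (Channel, k, m) \<omega>) * cnj (source_entry (Noise, k, m) \<omega>)" for \<omega>
      using True by (simp add: X_def observation_source d_def algebra_simps)
    show ?thesis
      using mom True unfolding X C_def
      by (simp add: source_power_def power2_eq_square algebra_simps)
  next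
    case False
    \<comment> \<open>For \<open>i \<noteq> k\<close> the channel entry of user \<open>k\<close> is
      itself a fresh centred source multiplying the observation of user \<open>i\<close>, so the
      summand \<open>S\<close> is 0.\<close>
    have *: "{(Channel, i, m), (Noise, i, m)} \<subseteq> sources" "(Channel, k, m) \<in> sources"
      "(Channel, k, m) \<notin> {(Channel, i, m), (Noise, i, m)}"
      using k i m False by auto
    have "(\<lambda>x. cnj (x (Channel, i, m) + of_real d * x (Noise, i, m)))
        \<in> borel_measurable (PiM {(Channel, i, m), (Noise, i, m)} (\<lambda>_. borel))"
      by measurable
    note mom = moments_add_mult_source[OF * _ this _ _ _ O, of "\<lambda>_. 0" "\<lambda>_. 0" 0 0 id]
    have "has_bochner_integral P (\<lambda>\<omega>. (cmod (0 + cnj (observation i m \<omega>) * id (source_entry (Channel, k, m) \<omega>)))\<^sup>2)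
        (0 + (\<beta> i + d\<^sup>2) * source_power (Channel, k, m))"
      by (rule mom(1)) (simp_all add: observation_source d_def has_bochner_integral_zero)
    moreover have "has_bochner_integral P (\<lambda>\<omega>. 0 + cnj (observation i m \<omega>) * id (source_entry (Channel, k, m) \<omega>)) 0"
      by (rule mom(2)) (simp_all add: observation_source d_def has_bochner_integral_zero)
    ultimately show ?thesis
      using False by (simp add: source_power_def X_def[abs_def] C_def mult.commute)
  qed
  \<comment> \<open>\<open>A\<close> holds the sources occurring in \<open>X\<close> and in the
    observation; it has only two elements when \<open>i = k\<close>.\<close>
  have *: "A \<subseteq> sources" "(Innovation, k, m) \<in> sources" "(Innovation, k, m) \<notin> A"
    using k i m by (auto simp: A_def)
  have aX: "has_bochner_integral P (\<lambda>\<omega>. (cmod (of_real \<alpha> * X \<omega>))\<^sup>2) (\<alpha>\<^sup>2 * (\<beta> k * (\<beta> i + d\<^sup>2) + C\<^sup>2))"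
    "has_bochner_integral P (\<lambda>\<omega>. of_real \<alpha> * X \<omega>) (of_real \<alpha> * of_real C)"
    using XA by (auto simp: norm_mult power_mult_distrib intro!: has_bochner_integral_mult_right)
  have [measurable]: "(\<lambda>x. x j) \<in> borel_measurable (PiM A (\<lambda>_. borel))" if "j \<in> A" for j
    using that by simp
  have [simp]: "(Channel, k, m) \<in> A" "(Channel, i, m) \<in> A" "(Noise, i, m) \<in> A"
    by (auto simp: A_def)
  have "(\<lambda>x. of_real \<alpha> * (x (Channel, k, m) * cnj (x (Channel, i, m) + of_real d * x (Noise, i, m))))
      \<in> borel_measurable (PiM A (\<lambda>_. borel))"
    "(\<lambda>x. cnj (x (Channel, i, m) + of_real d * x (Noise, i, m))) \<in> borel_measurable (PiM A (\<lambda>_. borel))"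
    by measurable
  note mom = moments_add_mult_source[OF * this _ aX(1) _ O aX(2), of id]
  have "has_bochner_integral P (\<lambda>\<omega>. (cmod (of_real \<alpha> * X \<omega> + cnj (observation i m \<omega>) * id (source_entry (Innovation, k, m) \<omega>)))\<^sup>2)
     (\<alpha>\<^sup>2 * (\<beta> k * (\<beta> i + d\<^sup>2) + C\<^sup>2) + (\<beta> i + d\<^sup>2) * source_power (Innovation, k, m))"
    by (rule mom(1)) (simp_all add: observation_source d_def X_def)
  then have mom1: "has_bochner_integral P (\<lambda>\<omega>. (cmod (gain_entry k i m \<omega>))\<^sup>2)
     (\<alpha>\<^sup>2 * (\<beta> k * (\<beta> i + d\<^sup>2) + C\<^sup>2) + (\<beta> i + d\<^sup>2) * source_power (Innovation, k, m))"
    by (simp add: gain_entry_def X_def)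
  have "has_bochner_integral P (\<lambda>\<omega>. of_real \<alpha> * X \<omega> + cnj (observation i m \<omega>) * id (source_entry (Innovation, k, m) \<omega>))
     (of_real \<alpha> * of_real C)"
    by (rule mom(2)) (simp_all add: observation_source d_def X_def)
  then have mom2: "has_bochner_integral P (gain_entry k i m) (of_real \<alpha> * of_real C)"
    by (simp add: gain_entry_def[abs_def] X_def)
  show "has_bochner_integral P (gain_entry k i m) (if i = k then of_real (\<alpha> * \<beta> k) else 0)"
    using mom2 by (auto simp: C_def)
  show "has_bochner_integral P (\<lambda>\<omega>. (cmod (gain_entry k i m \<omega>))\<^sup>2)
      (\<beta> k * (\<beta> i + (1 / sqrt p_p)\<^sup>2) + (if i = k then (\<alpha> * \<beta> k)\<^sup>2 else 0))"
    using mom1 unfolding d_def[symmetric]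
    by (auto simp: C_def source_power_def algebra_simps power_mult_distrib)
qed

text \<open>Sources are grouped into blocks by antenna. The blocks are disjoint, and the
  \<open>m\<close>-th gain is a function \<open>f m\<close> of its own block.\<close>

lemma indep_gain_entry:
  assumes "k \<in> {1..K}" "i \<in> {1..K}"
  shows "indep_vars (\<lambda>_. borel) (gain_entry k i) {1..M}"
proof -
  define d where "d = 1 / sqrt p_p"
  define f where "f m x = of_real \<alpha> * (x (Channel, k, m) * cnj (x (Channel, i, m) + of_real d * x (Noise, i, m)))
    + cnj (x (Channel, i, m) + of_real d * x (Noise, i, m)) * x (Innovation, k, m)"
    for m and x :: "source \<times> nat \<times> nat \<Rightarrow> complex"
  have "indep_vars (\<lambda>m. PiM (UNIV \<times> {1..K} \<times> {m}) (\<lambda>_. borel))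
     (\<lambda>m \<omega>. restrict (\<lambda>j. source_entry j \<omega>) (UNIV \<times> {1..K} \<times> {m})) {1..M}"
    by (rule indep_vars_restrict[OF indep_source_entry]) (auto simp: disjoint_family_on_def)
  then have "indep_vars (\<lambda>_. borel)
     (\<lambda>m \<omega>. f m (restrict (\<lambda>j. source_entry j \<omega>) (UNIV \<times> {1..K} \<times> {m}))) {1..M}"
  proof (rule indep_vars_compose2)
    fix m :: nat
    define A where "A = (UNIV :: source set) \<times> {1..K} \<times> {m}"
    have [measurable]: "(\<lambda>x. x (s, j, m)) \<in> borel_measurable (PiM A (\<lambda>_. borel :: complex measure))"
      if "j \<in> {1..K}" for s j
      using that by (auto simp: A_def intro: measurable_component_singleton)
    show "f m \<in> borel_measurable (PiM (UNIV \<times> {1..K} \<times> {m}) (\<lambda>_. borel))"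
      unfolding f_def[abs_def] A_def[symmetric] using assms by measurable
  qed
  then show ?thesis
    using assms unfolding f_def gain_entry_def[abs_def] by (simp add: observation_source d_def)
qed

lemma complex_variance_gain_entry:
  assumes "k \<in> {1..K}" "i \<in> {1..K}" "m \<in> {1..M}"
  shows "complex_variance P (gain_entry k i m) = \<beta> k * (\<beta> i + (1 / sqrt p_p)\<^sup>2)"
  using gain_entry_moments[OF assms]
  by (auto simp: complex_variance_def has_bochner_integral_iff norm_mult power_mult_distrib)

section \<open>Closed form of the achievable rate\<close>

text \<open>The existence of a user gives \<open>1 \<le> K\<close>, and
  \<open>K \<le> \<tau>\<close> then makes the training length positive.\<close>

lemma p_p_pos: "k \<in> {1..K} \<Longrightarrow> 0 < p_p"
  using training p_u by (simp add: p_p_def)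

lemma effective_gain_eq:
  assumes "k \<in> {1..K}" "\<omega> \<in> space P"
  shows "effective_gain k i \<omega> =
    of_real (\<alpha> * (p_p * \<beta> i / (1 + p_p * \<beta> i))) * (\<Sum>m = 1..M. gain_entry k i m \<omega>)"
  unfolding effective_gain_def sum_distrib_left
  using assms
  by (intro sum.cong refl)
    (simp add: aging aged_csi_def mmse_estimate_def gain_entry_def source_entry_def ring_distribs add_divide_distrib mult_ac)

lemma complex_variance_cong:
  "(\<And>\<omega>. \<omega> \<in> space P \<Longrightarrow> X \<omega> = Y \<omega>) \<Longrightarrow> complex_variance P X = complex_variance P Y"
  by (simp add: complex_variance_def cong: Bochner_Integration.integral_cong)

text \<open>The sum over antennas contributes the factor \<open>M\<close> to both mean and variance.
  With \<open>c\<close> the MMSE coefficient, the rest is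
  \<open>c * \<beta> k = estimate_variance k\<close> (for \<open>i = k\<close>) and
  \<open>c^2 * (\<beta> i + 1 / p_p) = estimate_variance i\<close>.\<close>

lemma effective_gain_moments:
  assumes k: "k \<in> {1..K}" and i: "i \<in> {1..K}"
  shows "expectation (effective_gain k i) = (if i = k then of_real (real M * \<alpha>\<^sup>2 * estimate_variance k) else 0)"
    and "complex_variance P (effective_gain k i) = real M * \<alpha>\<^sup>2 * \<beta> k * estimate_variance i"
proof -
  define c where "c = p_p * \<beta> i / (1 + p_p * \<beta> i)"
  let ?X = "\<lambda>\<omega>. \<Sum>m = 1..M. gain_entry k i m \<omega>"
  have pos: "0 < p_p" "0 < 1 + p_p * \<beta> i" "0 < \<beta> i"
    using p_p_pos[OF k] \<beta>[OF i] by (auto intro: add_pos_pos)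
  have "expectation (effective_gain k i) = expectation (\<lambda>\<omega>. of_real (\<alpha> * c) * ?X \<omega>)"
    by (intro Bochner_Integration.integral_cong refl) (simp only: effective_gain_eq[OF k] c_def)
  also have "\<dots> = of_real (\<alpha> * c) * (\<Sum>m = 1..M. expectation (gain_entry k i m))"
    using gain_entry_moments(1)[OF k i]
    by (subst Bochner_Integration.integral_mult_right_zero, subst Bochner_Integration.integral_sum)
      (auto simp: has_bochner_integral_iff)
  also have "\<dots> = of_real (\<alpha> * c) * (\<Sum>m = 1..M. if i = k then of_real (\<alpha> * \<beta> k) else 0)"
    using gain_entry_moments(1)[OF k i] by (simp add: has_bochner_integral_iff)
  also have "\<dots> = (if i = k then of_real (real M * \<alpha>\<^sup>2 * estimate_variance k) else 0)"
    by (simp add: c_def estimate_variance_def power2_eq_square)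
  finally show "expectation (effective_gain k i) = (if i = k then of_real (real M * \<alpha>\<^sup>2 * estimate_variance k) else 0)" .
  have "complex_variance P (effective_gain k i) = complex_variance P (\<lambda>\<omega>. of_real (\<alpha> * c) * ?X \<omega>)"
    by (intro complex_variance_cong) (simp only: effective_gain_eq[OF k] c_def)
  also have "\<dots> = (\<alpha> * c)\<^sup>2 * complex_variance P ?X"
    by (simp only: complex_variance_def norm_mult norm_of_real power_mult_distrib power2_abs
        Bochner_Integration.integral_mult_right_zero right_diff_distrib)
  also have "complex_variance P ?X = (\<Sum>m = 1..M. complex_variance P (gain_entry k i m))"
    using gain_entry_moments(2)[OF k i]
    by (intro complex_variance_sum_indep indep_gain_entry k i) (auto simp: has_bochner_integral_iff)
  also have "\<dots> = real M * (\<beta> k * (\<beta> i + (1 / sqrt p_p)\<^sup>2))"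
    using complex_variance_gain_entry[OF k i] by simp
  also have "(1 / sqrt p_p)\<^sup>2 = 1 / p_p"
    using pos by (simp add: power_divide)
  also have "(\<alpha> * c)\<^sup>2 * (real M * (\<beta> k * (\<beta> i + 1 / p_p))) = real M * \<alpha>\<^sup>2 * \<beta> k * (c\<^sup>2 * (\<beta> i + 1 / p_p))"
    by (simp add: power_mult_distrib)
  also have "c\<^sup>2 * (\<beta> i + 1 / p_p) = estimate_variance i"
  proof -
    have "\<beta> i + 1 / p_p = (1 + p_p * \<beta> i) / p_p"
      using pos by (simp add: field_simps)
    then show ?thesis
      using pos by (simp add: c_def estimate_variance_def power2_eq_square)
  qed
  finally show "complex_variance P (effective_gain k i) = real M * \<alpha>\<^sup>2 * \<beta> k * estimate_variance i" .
qed

lemma estimate_variance_pos: "k \<in> {1..K} \<Longrightarrow> 0 < estimate_variance k"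
  using p_p_pos[of k] \<beta>[of k] by (simp add: estimate_variance_def add_pos_pos)

text \<open>The denominator of the SINR is \<open>A * S * (\<beta> k + 1 / p_b)\<close> and the
  numerator is \<open>A^2 * (estimate_variance k)^2\<close>, so one factor \<open>A\<close>
  cancels.\<close>

lemma downlink_rate_eq:
  assumes k: "k \<in> {1..K}"
  shows "downlink_rate k = log 2 (1 + real M * \<alpha>\<^sup>2 * (estimate_variance k)\<^sup>2 /
      ((\<Sum>i = 1..K. estimate_variance i) * (\<beta> k + 1 / p_b)))"
proof -
  define A where "A = real M * \<alpha>\<^sup>2"
  define S where "S = (\<Sum>i = 1..K. estimate_variance i)"
  have A: "0 < A"
    using k users \<alpha> by (auto simp: A_def)
  have S: "0 < S"
    unfolding S_def using k by (intro sum_pos) (auto intro: estimate_variance_pos)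
  \<comment> \<open>The mean is 0 for \<open>i \<noteq> k\<close>, so the second moment is the
    variance.\<close>
  have interference: "(\<integral>\<omega>. (cmod (effective_gain k i \<omega>))\<^sup>2 \<partial>P) = A * \<beta> k * estimate_variance i"
    if "i \<in> {1..K} - {k}" for i
    using effective_gain_moments[OF k, of i] that by (auto simp: complex_variance_def A_def)
  \<comment> \<open>The variance of the user's own gain supplies the summand \<open>i = k\<close>
    missing from the interference.\<close>
  have "S = estimate_variance k + (\<Sum>i \<in> {1..K} - {k}. estimate_variance i)"
    unfolding S_def using k by (intro sum.remove) auto
  then have "complex_variance P (effective_gain k k)
        + (\<Sum>i \<in> {1..K} - {k}. \<integral>\<omega>. (cmod (effective_gain k i \<omega>))\<^sup>2 \<partial>P) = A * \<beta> k * S"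
    using effective_gain_moments(2)[OF k k] interference
    by (simp add: A_def sum_distrib_left[symmetric] ring_distribs)
  moreover have "1 / (p_b * mrt_scale\<^sup>2) = A * S / p_b"
  proof -
    have "mrt_scale\<^sup>2 = (A * S) powr (-1)"
      unfolding mrt_scale_def A_def[symmetric] S_def[symmetric]
      by (simp add: power2_eq_square powr_add[symmetric])
    also have "\<dots> = 1 / (A * S)"
      using A S by (subst powr_minus_divide) simp
    finally show ?thesis
      using A S by simp
  qed
  moreover have "(cmod (\<integral>\<omega>. effective_gain k k \<omega> \<partial>P))\<^sup>2 = A\<^sup>2 * (estimate_variance k)\<^sup>2"
    using effective_gain_moments(1)[OF k k]
    by (simp only: norm_of_real simp_thms if_True power2_abs A_def power_mult_distrib)
  moreover have "A\<^sup>2 * (estimate_variance k)\<^sup>2 / (A * \<beta> k * S + A * S / p_b) =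
      A * (estimate_variance k)\<^sup>2 / (S * (\<beta> k + 1 / p_b))"
  proof -
    have "A * \<beta> k * S + A * S / p_b = A * (S * (\<beta> k + 1 / p_b))"
      by (simp add: ring_distribs)
    then show ?thesis
      using A by (simp only: power2_eq_square) simp
  qed
  ultimately show ?thesis
    unfolding downlink_rate_def A_def[symmetric] S_def[symmetric] by simp
qed

end

section \<open>Asymptotics under the power scaling\<close>

text \<open>The quotient \<open>(1 + y * r) / (1 + y)\<close> equals
  \<open>1 + (r - 1) * (y / (1 + y))\<close>, and \<open>y / (1 + y)\<close> stays in
  \<open>[0, 1)\<close> however large \<open>y\<close> is.\<close>

lemma tendsto_log_ratio:
  fixes y r :: "nat \<Rightarrow> real"
  assumes y: "\<And>n. 0 \<le> y n" and r: "r \<longlonglongrightarrow> 1"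
  shows "(\<lambda>n. log 2 (1 + y n * r n) - log 2 (1 + y n)) \<longlonglongrightarrow> 0"
proof -
  define h where "h n = 1 + (r n - 1) * (y n / (1 + y n))" for n
  have "(\<lambda>n. (r n - 1) * (y n / (1 + y n))) \<longlonglongrightarrow> 0"
  proof (rule Lim_null_comparison)
    show "\<forall>\<^sub>F n in sequentially. norm ((r n - 1) * (y n / (1 + y n))) \<le> \<bar>r n - 1\<bar>"
    proof (intro always_eventually allI)
      fix n
      have "\<bar>y n / (1 + y n)\<bar> \<le> 1"
        using y[of n] by simp
      then show "norm ((r n - 1) * (y n / (1 + y n))) \<le> \<bar>r n - 1\<bar>"
        by (simp only: real_norm_def abs_mult) (rule mult_left_le, simp_all)
    qed
    show "(\<lambda>n. \<bar>r n - 1\<bar>) \<longlonglongrightarrow> 0"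
      using tendsto_rabs[OF tendsto_diff[OF r tendsto_const[of 1]]] by simp
  qed
  then have "h \<longlonglongrightarrow> 1"
    unfolding h_def[abs_def] using tendsto_add[OF tendsto_const[of "1::real"]] by fastforce
  then have "(\<lambda>n. log 2 (h n)) \<longlonglongrightarrow> log 2 1"
    by (intro tendsto_log tendsto_const) auto
  \<comment> \<open>\<open>r\<close> is eventually positive, so \<open>1 + y n * r n\<close> is
    positive and the logarithm of the quotient splits.\<close>
  moreover have "\<forall>\<^sub>F n in sequentially. log 2 (h n) = log 2 (1 + y n * r n) - log 2 (1 + y n)"
    using order_tendstoD(1)[OF r zero_less_one]
  proof eventually_elim
    case (elim n)
    have "h n = (1 + y n * r n) / (1 + y n)"
      using y[of n] by (simp add: h_def field_simps)
    moreover have "0 < 1 + y n * r n" "0 < 1 + y n"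
      using y[of n] elim by (auto intro: add_pos_nonneg)
    ultimately show ?case
      by (simp add: log_divide)
  qed
  ultimately show ?thesis
    by (simp add: tendsto_cong)
qed

theorem theorem10:
  fixes P :: "nat \<Rightarrow> 'a measure"
    and K \<tau> n k :: nat
    and \<alpha> E_u E_b \<beta> :: real
    and \<beta>' :: "nat \<Rightarrow> real"
    and g b e :: "nat \<Rightarrow> nat \<Rightarrow> nat \<Rightarrow> nat \<Rightarrow> 'a \<Rightarrow> complex"
  assumes "0 < E_u" and "0 < E_b" and "0 < \<beta>"
    and "\<And>M. K \<le> M \<Longrightarrow>
      aged_downlink (P M) M K \<tau> n (E_u / sqrt (real M)) (E_b / real M powr \<beta>) \<alpha> \<beta>' (g M) (b M) (e M)"
    and "k \<in> {1..K}"
  shows "(\<lambda>M.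
      aged_downlink.downlink_rate (P M) M K \<tau> n (E_u / sqrt (real M)) (E_b / real M powr \<beta>)
        \<alpha> \<beta>' (g M) (b M) k
      - log 2 (1 + \<alpha>\<^sup>2 * real \<tau> * E_u * E_b * \<beta>' k ^ 4 /
          (real M powr (\<beta> - 1/2) * (\<Sum>i = 1..K. (\<beta>' i)\<^sup>2))))
    \<longlonglongrightarrow> 0"
proof -
  \<comment> \<open>The instance \<open>M = K\<close> supplies the facts about \<open>\<tau>\<close>
    and \<open>\<beta>'\<close>, which do not depend on \<open>M\<close>.\<close>
  interpret K: aged_downlink "P K" K K \<tau> n "E_u / sqrt (real K)" "E_b / real K powr \<beta>" \<alpha> \<beta>' "g K" "b K" "e K"
    by (rule assms(4)) simp
  have pos: "0 < \<beta>' i" if "i \<in> {1..K}" for i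
    using K.\<beta>[OF that] .
  have \<tau>: "0 < real \<tau>"
    using K.training assms(5) by simp
  define S where "S = (\<Sum>i = 1..K. (\<beta>' i)\<^sup>2)"
  \<comment> \<open>\<open>t M\<close> is the pilot power \<open>p_p\<close>, \<open>w i M\<close>
    the estimate variance divided by it, \<open>y M\<close> the claimed SINR, and \<open>r M\<close>
    the ratio of the exact SINR to \<open>y M\<close>, arranged so that each factor of
    \<open>r M\<close> tends to 1.\<close>
  define t where "t M = real \<tau> * (E_u / sqrt (real M))" for M :: nat
  define w where "w i M = (\<beta>' i)\<^sup>2 / (1 + t M * \<beta>' i)" for i M
  define y where "y M = \<alpha>\<^sup>2 * real \<tau> * E_u * E_b * \<beta>' k ^ 4 / (real M powr (\<beta> - 1/2) * S)" for M :: nat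
  define r where "r M = (w k M)\<^sup>2 / \<beta>' k ^ 4 * (S / (\<Sum>i = 1..K. w i M)) / (E_b * \<beta>' k * real M powr (-\<beta>) + 1)"
    for M :: nat
  have S: "0 < S"
    unfolding S_def using assms(5) pos by (intro sum_pos) (auto simp: less_imp_neq[symmetric])
  have "t \<longlonglongrightarrow> 0"
    unfolding t_def[abs_def]
    by (intro tendsto_mult_right_zero tendsto_divide_0[OF tendsto_const]
        filterlim_at_top_imp_at_infinity filterlim_compose[OF sqrt_at_top] filterlim_real_sequentially)
  then have w: "(\<lambda>M. w i M) \<longlonglongrightarrow> (\<beta>' i)\<^sup>2" for i
    unfolding w_def by (auto intro!: tendsto_eq_intros)
  \<comment> \<open>Here \<open>0 < \<beta>\<close> enters: the BS power tends to 0, so noise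
    dominates the term \<open>\<beta>' k\<close> from the interference.\<close>
  have powr0: "(\<lambda>M. real M powr (-\<beta>)) \<longlonglongrightarrow> 0"
    using assms(3) by (intro tendsto_neg_powr filterlim_real_sequentially) auto
  have wsum: "(\<lambda>M. \<Sum>i = 1..K. w i M) \<longlonglongrightarrow> S"
    unfolding S_def by (intro tendsto_sum w)
  have "r \<longlonglongrightarrow> ((\<beta>' k)\<^sup>2)\<^sup>2 / \<beta>' k ^ 4 * (S / S) / (E_b * \<beta>' k * 0 + 1)"
    unfolding r_def[abs_def]
    using S pos[OF assms(5)]
    by (intro tendsto_intros w powr0 wsum) auto
  then have r: "r \<longlonglongrightarrow> 1"
    using S pos[OF assms(5)] by (simp add: power_mult[symmetric])
  \<comment> \<open>This includes \<open>M = 0\<close>, where the denominator is 0 and the quotient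
    is 0 by convention.\<close>
  have y0: "0 \<le> y M" for M
    unfolding y_def using assms(1,2) S \<tau> pos[OF assms(5)] by simp
  have rate: "aged_downlink.downlink_rate (P M) M K \<tau> n (E_u / sqrt (real M)) (E_b / real M powr \<beta>)
        \<alpha> \<beta>' (g M) (b M) k = log 2 (1 + y M * r M)" if "K \<le> M" for M
  proof -
    interpret aged_downlink "P M" M K \<tau> n "E_u / sqrt (real M)" "E_b / real M powr \<beta>" \<alpha> \<beta>' "g M" "b M" "e M"
      by (rule assms(4)) fact
    have M: "0 < real M"
      using that assms(5) by simp
    \<comment> \<open>The antenna factor \<open>M\<close> against a pilot power of order
      \<open>1 / sqrt M\<close> leaves \<open>sqrt M\<close>; this is the source of the exponent
      \<open>\<beta> - 1/2\<close>.\<close>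
    have tM: "0 < t M" "real M * t M = real \<tau> * E_u * sqrt (real M)"
      using M \<tau> assms(1) by (simp_all add: t_def real_div_sqrt field_simps)
    have est: "estimate_variance i = t M * w i M" for i
      by (simp add: estimate_variance_def p_p_def t_def w_def)
    define W where "W = (\<Sum>i = 1..K. w i M)"
    have W: "0 < W"
      unfolding W_def using assms(5) pos tM
      by (intro sum_pos) (auto simp: w_def add_pos_pos less_imp_neq[symmetric])
    define q where "q = real M powr \<beta>"
    have q: "0 < q" "real M powr (-\<beta>) = 1 / q" "real M powr (\<beta> - 1/2) = q / sqrt (real M)"
      using M by (simp_all add: q_def powr_minus_divide powr_diff powr_half_sqrt)
    have bk: "0 < \<beta>' k"
      by (rule pos[OF assms(5)])
    have "real M * \<alpha>\<^sup>2 * (estimate_variance k)\<^sup>2 /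
        ((\<Sum>i = 1..K. estimate_variance i) * (\<beta>' k + 1 / (E_b / real M powr \<beta>))) =
        (real M * t M) * \<alpha>\<^sup>2 * (w k M)\<^sup>2 / (W * (\<beta>' k + q / E_b))"
      using tM(1) unfolding est W_def q_def
      by (simp add: sum_distrib_left[symmetric] power2_eq_square)
    also have "\<dots> = real \<tau> * E_u * sqrt (real M) * \<alpha>\<^sup>2 * (w k M)\<^sup>2 / (W * (\<beta>' k + q / E_b))"
      by (simp only: tM(2))
    \<comment> \<open>The dominant noise term is factored out; what remains is the last denominator
      of \<open>r\<close>.\<close>
    also have "\<beta>' k + q / E_b = q / E_b * (E_b * \<beta>' k * (1 / q) + 1)"
      using q assms(2) by (simp add: field_simps)
    also have "real \<tau> * E_u * sqrt (real M) * \<alpha>\<^sup>2 * (w k M)\<^sup>2 / (W * (q / E_b * (E_b * \<beta>' k * (1 / q) + 1))) = y M * r M"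
      unfolding y_def r_def q W_def[symmetric]
      using S bk by (simp add: mult_ac)
    finally show ?thesis
      unfolding downlink_rate_eq[OF assms(5)] by simp
  qed
  have "(\<lambda>M. log 2 (1 + y M * r M) - log 2 (1 + y M)) \<longlonglongrightarrow> 0"
    by (rule tendsto_log_ratio[OF y0 r])
  \<comment> \<open>The exact form of the rate is available for \<open>K \<le> M\<close>, hence
    eventually.\<close>
  then show ?thesis
    unfolding S_def[symmetric] y_def[symmetric]
    by (rule Lim_transform_eventually) (use eventually_ge_at_top[of K] in eventually_elim, simp add: rate)
qed

end
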